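(* Let $S$ be a real linear space of finite dimension $D$ endowed with two arbitrary norms $\|\cdot\|_2$ and $\|\cdot\|_\infty$. Let $T\subset S$ be a countable nonempty set, let $t_0\in T$, and let $(X_t)_{t\in T}$ be a family of real-valued centered random variables. Let $v>0$, $b\ge 0$ and $c\ge 0$ be constants such that $$T\subset\left\{t\in S:\ \|t-t_0\|_2\le v,\ \ c\|t-t_0\|_\infty\le b\right\}.$$ Assume that for all $s,t\in T$ with $s\neq t$, $$\mathbb{E}\left[e^{\lambda(X_t-X_s)}\right]\le \exp\left[\frac{\lambda^2\|t-s\|_2^2}{2(1-\lambda c\|t-s\|_\infty)}\right],\qquad \forall \lambda\in\left[0,\frac{1}{c\|t-s\|_\infty}\right),$$ with the convention $1/0=+\infty$. Set $Z=\sup_{t\in T}(X_t-X_{t_0})$ and $\overline{Z}=\sup_{t\in T}|X_t-X_{t_0}|$. Then, with $\kappa=18$, $$\mathbb{P}\left[Z\ge \kappa\left(\sqrt{v^2(D+x)}+b(D+x)\right)\right]\le e^{-x},\qquad \forall x\ge 0,$$ and moreover $$\mathbb{P}\left[\overline{Z}\ge \kappa\left(\sqrt{v^2(D+x)}+b(D+x)\right)\right]\le 2e^{-x},\qquad \forall x\ge 0.$$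
   Context: All random variables are defined on a common probability space with probability $\mathbb{P}$ and expectation $\mathbb{E}$. Centered means having expectation $0$. The two norms are arbitrary norms on $S$; the subscripts $2$ and $\infty$ are only labels. *)

theory Defs
  imports "HOL-Probability.Probability"
begin

text \<open>
  The type class \<^class>\<open>real_normed_vector\<close> fixes a single norm per type; since two unrelated norms
  on the same space are needed, a norm is a predicate on functions, relative to the subspace \<open>S\<close>
  (values outside \<open>S\<close> are irrelevant).
\<close>

definition norm_on :: "'a::real_vector set \<Rightarrow> ('a \<Rightarrow> real) \<Rightarrow> bool" where
  "norm_on S N \<longleftrightarrow>
     (\<forall>x\<in>S. N x \<ge> 0) \<and>
     (\<forall>x\<in>S. N x = 0 \<longleftrightarrow> x = 0) \<and>
     (\<forall>a. \<forall>x\<in>S. N (a *\<^sub>R x) = \<bar>a\<bar> * N x) \<and>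
     (\<forall>x\<in>S. \<forall>y\<in>S. N (x + y) \<le> N x + N y)"

text \<open>
  Finiteness of a spanning set is required explicitly because \<open>dim\<close> is \<open>0\<close> on
  infinite-dimensional subspaces.
\<close>

definition finite_dim_space :: "'a::real_vector set \<Rightarrow> nat \<Rightarrow> bool" where
  "finite_dim_space S D \<longleftrightarrow> subspace S \<and> (\<exists>B. finite B \<and> span B = S) \<and> dim S = D"

definition centered_rv :: "'w measure \<Rightarrow> ('w \<Rightarrow> real) \<Rightarrow> bool" where
  "centered_rv M Y \<longleftrightarrow> Y \<in> borel_measurable M \<and> integrable M Y \<and> (LINT w|M. Y w) = 0"

text \<open>
  The suprema are taken in \<^typ>\<open>ereal\<close>: the family may be unbounded at some sample points, where a
  real-valued supremum would be unspecified.
\<close>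

definition sup_increment :: "('a \<Rightarrow> 'w \<Rightarrow> real) \<Rightarrow> 'a set \<Rightarrow> 'a \<Rightarrow> 'w \<Rightarrow> ereal" where
  "sup_increment X T t0 w = (SUP t\<in>T. ereal (X t w - X t0 w))"

definition sup_abs_increment :: "('a \<Rightarrow> 'w \<Rightarrow> real) \<Rightarrow> 'a set \<Rightarrow> 'a \<Rightarrow> 'w \<Rightarrow> ereal" where
  "sup_abs_increment X T t0 w = (SUP t\<in>T. ereal \<bar>X t w - X t0 w\<bar>)"

text \<open>
  The range of \<open>l\<close> is \<open>[0, 1 / (c N\<^sub>\<infinity>(t - s)))\<close>; its right endpoint is computed in
  \<^typ>\<open>ereal\<close>, where \<open>1 / 0 = \<infinity>\<close>.  Integrability is stated separately because the Bochner
  integral of a non-integrable function is \<open>0\<close>, whereas the expectation of a nonnegative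
  variable would be \<open>\<infinity>\<close>.
\<close>

definition bernstein_increments ::
  "'w measure \<Rightarrow> 'a::real_vector set \<Rightarrow> ('a \<Rightarrow> 'w \<Rightarrow> real) \<Rightarrow>
   ('a \<Rightarrow> real) \<Rightarrow> ('a \<Rightarrow> real) \<Rightarrow> real \<Rightarrow> bool" where
  "bernstein_increments M T X N2 Ninf c \<longleftrightarrow>
     (\<forall>s\<in>T. \<forall>t\<in>T. s \<noteq> t \<longrightarrow>
       (\<forall>l::real. 0 \<le> l \<and> ereal l < 1 / ereal (c * Ninf (t - s)) \<longrightarrow>
          integrable M (\<lambda>w. exp (l * (X t w - X s w))) \<and>
          (LINT w|M. exp (l * (X t w - X s w)))
            \<le> exp (l\<^sup>2 * (N2 (t - s))\<^sup>2 / (2 * (1 - l * c * Ninf (t - s))))))"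

end

theory Submission imports Defs begin

text \<open>
  The proof is chaining, with nets counted by volume.  After rescaling, the maximum of the two norms turns
  \<open>T\<close> into a subset of the unit ball about \<open>t0\<close>, and a link of length \<open>\<delta>\<close> in this combined seminorm has a Bernstein tail: it
  exceeds \<open>\<delta> * (v * sqrt (2 * y) + b * y)\<close> with probability at most \<open>exp (- y)\<close> (\<open>bernstein_tail\<close>).  Comparing volumes
  of balls, a \<open>\<delta>\<close>-separated subset of the unit ball of a \<open>D\<close>-dimensional space has at most \<open>(1 + 2 / \<delta>) ^ D\<close>
  points (\<open>seminorm_packing\<close>), whatever the norm is.  This bound depends on the norms only through \<open>D\<close>, which is why the
  same constant serves every pair of norms.

  For nets of scale \<open>2\<^sup>-\<^sup>k\<close> the logarithm of the number of links grows like \<open>k * D\<close>, while their lengths decrease like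
  \<open>2\<^sup>-\<^sup>k\<close>.  Choosing the deviation level of the links from scale \<open>2\<^sup>-\<^sup>k\<^sup>-\<^sup>1\<close> to scale \<open>2\<^sup>-\<^sup>k\<close> as \<open>(2 * k + 4) * (D + x)\<close>
  makes the failure probabilities add up to at most \<open>exp (- x)\<close> (\<open>net_card_weight\<close>), and the increments along any chain
  add up to at most \<open>12 * (v * sqrt (D + x) + b * (D + x))\<close>, because \<open>\<Sum>k. (2 * k + 4) / 2 ^ k = 12\<close> (\<open>chaining_series\<close>).

  Chains are finite when the index set is finite (\<open>chaining_tail\<close>, \<open>finite_increment_tail\<close>), and countable index sets
  follow by monotone approximation.  The room between \<open>12\<close> and \<open>18\<close> takes care of suprema that are not attained.
  The two-sided bound is the one-sided bound for \<open>X\<close> and for \<open>- X\<close>.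
\<close>

section \<open>Packing numbers of balls of seminorms\<close>

text \<open>
  Chaining measures distances by the maximum of two rescaled norms.  One of the two scale factors may
  vanish, and a norm scaled by \<open>0\<close> is still a seminorm.
\<close>

definition seminorm_on :: "'a::real_vector set \<Rightarrow> ('a \<Rightarrow> real) \<Rightarrow> bool" where
  "seminorm_on S p \<longleftrightarrow>
     (\<forall>x\<in>S. 0 \<le> p x) \<and>
     (\<forall>a. \<forall>x\<in>S. p (a *\<^sub>R x) = \<bar>a\<bar> * p x) \<and>
     (\<forall>x\<in>S. \<forall>y\<in>S. p (x + y) \<le> p x + p y)"

lemma seminorm_on_minus:
  assumes "seminorm_on S p" "x \<in> S"
  shows "p (- x) = p x"
  using assms unfolding seminorm_on_def by (metis abs_minus_cancel abs_one mult_1 scaleR_minus1_left)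

lemma seminorm_on_sum:
  assumes p: "seminorm_on S p" and S: "subspace S" and "finite B" "\<And>e. e \<in> B \<Longrightarrow> f e \<in> S"
  shows "p (\<Sum>e\<in>B. f e) \<le> (\<Sum>e\<in>B. p (f e))"
  using assms(3,4)
proof (induction B rule: finite_induct)
  case empty
  have "p (0 *\<^sub>R 0) = \<bar>0\<bar> * p 0"
    using p subspace_0[OF S] unfolding seminorm_on_def by blast
  then show ?case by simp
next
  case (insert e B)
  have "p (f e + (\<Sum>e\<in>B. f e)) \<le> p (f e) + p (\<Sum>e\<in>B. f e)"
    using p insert.prems subspace_sum[OF S, of B f] unfolding seminorm_on_def by auto
  then show ?case using insert by auto
qed

text \<open>
  An abstract finite-dimensional space carries no Lebesgue measure.  Coordinates with respect to a
  finite spanning set \<open>B\<close> transport the problem to \<open>\<real>\<^sup>B\<close>, realised as the product measure space over \<open>B\<close>.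
\<close>

definition lin_comb :: "'a::real_vector set \<Rightarrow> ('a \<Rightarrow> real) \<Rightarrow> 'a" where
  "lin_comb B x = (\<Sum>e\<in>B. x e *\<^sub>R e)"

lemma lin_comb_in_span: "lin_comb B x \<in> span B"
  unfolding lin_comb_def by (intro span_sum span_scale span_base)

lemma lin_comb_homothety:
  "lin_comb B (\<lambda>e\<in>B. (x e - z e) / r) = (1 / r) *\<^sub>R (lin_comb B x - lin_comb B z)"
  by (simp add: lin_comb_def scaleR_right.sum sum_subtractf[symmetric] diff_divide_distrib
      algebra_simps divide_inverse cong: sum.cong)

lemma span_lin_comb:
  assumes "finite B" "x \<in> span B"
  obtains z where "lin_comb B z = x"
  using assms by (auto simp: span_finite lin_comb_def)

text \<open>
  The one-dimensional change of variables scales the length of each side of a box, and the product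
  measure is determined by its values on boxes.
\<close>

lemma emeasure_PiM_lborel_homothety:
  fixes B :: "'i set" and z :: "'i \<Rightarrow> real"
  defines "V \<equiv> PiM B (\<lambda>_. lborel :: real measure)"
  assumes B: "finite B" and r: "r > 0" and A: "A \<in> sets V"
  shows "emeasure V {x \<in> space V. (\<lambda>i\<in>B. (x i - z i) / r) \<in> A} = ennreal (r ^ card B) * emeasure V A"
proof -
  define T where "T = (\<lambda>x. \<lambda>i\<in>B. (x i - z i) / r)"
  define n where "n = card B"
  interpret product_sigma_finite "\<lambda>_ :: 'i. lborel :: real measure" ..
  have T: "T \<in> measurable V V"
    unfolding V_def T_def by (intro measurable_restrict) auto
  have one: "emeasure lborel C = ennreal (1 / r) * emeasure lborel ((\<lambda>y. (y - a) / r) -` C)"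
    if "C \<in> sets lborel" for C and a :: real
  proof -
    have eq: "lborel = density (distr lborel borel (\<lambda>x. (- a / r) + (1 / r) * x)) (\<lambda>_. ennreal \<bar>1 / r\<bar>)"
      using r by (intro lborel_real_affine) auto
    have "(\<lambda>x. (- a / r) + (1 / r) * x) = (\<lambda>y. (y - a) / r)"
      by (auto simp: diff_divide_distrib)
    moreover have "emeasure lborel C = ennreal \<bar>1 / r\<bar> *
        emeasure lborel ((\<lambda>x. (- a / r) + (1 / r) * x) -` C)"
      using that by (subst eq) (simp add: emeasure_density_const emeasure_distr)
    ultimately show ?thesis using r by simp
  qed
  have "scale_measure (ennreal (1 / r ^ n)) (distr V V T) = V"
    unfolding V_def
  proof (rule PiM_eqI[OF B])
    show "sets (scale_measure (ennreal (1 / r ^ n)) (distr (PiM B (\<lambda>_. lborel)) (PiM B (\<lambda>_. lborel)) T)) =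
        sets (PiM B (\<lambda>_. lborel))" by simp
  next
    fix C :: "'i \<Rightarrow> real set" assume C: "\<And>i. i \<in> B \<Longrightarrow> C i \<in> sets lborel"
    have "T -` (Pi\<^sub>E B C) \<inter> space V = Pi\<^sub>E B (\<lambda>i. (\<lambda>y. (y - z i) / r) -` C i)"
      by (auto simp: T_def V_def space_PiM PiE_iff extensional_def)
    then have "emeasure V (T -` (Pi\<^sub>E B C) \<inter> space V) =
        (\<Prod>i\<in>B. emeasure lborel ((\<lambda>y. (y - z i) / r) -` C i))"
      unfolding V_def using B C
      by (simp, intro emeasure_PiM) (auto intro!: measurable_sets_borel[of _ borel])
    then have "ennreal (1 / r ^ n) * emeasure V (T -` (Pi\<^sub>E B C) \<inter> space V) =
        (\<Prod>i\<in>B. ennreal (1 / r) * emeasure lborel ((\<lambda>y. (y - z i) / r) -` C i))"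
      using r by (simp add: prod.distrib n_def ennreal_power power_one_over)
    also have "\<dots> = (\<Prod>i\<in>B. emeasure lborel (C i))"
      using one C by (intro prod.cong) auto
    finally show "emeasure (scale_measure (ennreal (1 / r ^ n))
          (distr (PiM B (\<lambda>_. lborel)) (PiM B (\<lambda>_. lborel)) T)) (Pi\<^sub>E B C) =
        (\<Prod>i\<in>B. emeasure lborel (C i))"
      using T C B unfolding V_def by (simp add: emeasure_distr sets_PiM_I_finite)
  qed
  then have "emeasure V A = ennreal (1 / r ^ n) * emeasure V (T -` A \<inter> space V)"
    using T A by (metis emeasure_distr emeasure_scale_measure)
  then have "ennreal (r ^ n) * emeasure V A =
      (ennreal (r ^ n) * ennreal (1 / r ^ n)) * emeasure V (T -` A \<inter> space V)"
    by (simp add: mult.assoc)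
  also have "ennreal (r ^ n) * ennreal (1 / r ^ n) = 1"
    using r by (simp add: ennreal_mult[symmetric])
  finally show ?thesis
    by (simp only: T_def n_def vimage_def Int_def conj_commute mem_Collect_eq mult_1)
qed

text \<open>
  A seminorm is Lipschitz in the coordinates, with constants \<open>p e\<close>.  Hence the open ball is the union,
  over the countably many rational points \<open>q\<close> in it, of the regions in which the Lipschitz bound
  starting from \<open>q\<close> already certifies \<open>p < 1\<close>; each such region is visibly measurable.
\<close>

lemma measurable_seminorm_ball:
  fixes B :: "'a::real_vector set"
  assumes B: "finite B" and p: "seminorm_on (span B) p"
  shows "{x \<in> space (PiM B (\<lambda>_. lborel :: real measure)). p (lin_comb B x) < 1}
           \<in> sets (PiM B (\<lambda>_. lborel))"
proof -
  define V where "V = PiM B (\<lambda>_. lborel :: real measure)"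
  define Q where "Q = {q \<in> Pi\<^sub>E B (\<lambda>_. \<rat>). p (lin_comb B q) < 1}"
  define L where "L = (\<lambda>q x. \<Sum>e\<in>B. \<bar>x e - q e\<bar> * p e)"
  have pe: "0 \<le> p e" if "e \<in> B" for e
    using p that unfolding seminorm_on_def by (auto intro: span_base)
  have lip: "p (lin_comb B x) \<le> p (lin_comb B q) + L q x" for x q
  proof -
    have eq: "lin_comb B x = lin_comb B q + (\<Sum>e\<in>B. (x e - q e) *\<^sub>R e)"
      by (simp add: lin_comb_def sum.distrib[symmetric] algebra_simps)
    have "p (\<Sum>e\<in>B. (x e - q e) *\<^sub>R e) \<le> (\<Sum>e\<in>B. p ((x e - q e) *\<^sub>R e))"
      by (rule seminorm_on_sum[OF p subspace_span B]) (auto intro: span_base span_scale)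
    also have "\<dots> = L q x"
      unfolding L_def using p by (intro sum.cong) (auto simp: seminorm_on_def intro: span_base)
    finally have 1: "p (\<Sum>e\<in>B. (x e - q e) *\<^sub>R e) \<le> L q x" .
    have "p (lin_comb B q + (\<Sum>e\<in>B. (x e - q e) *\<^sub>R e))
        \<le> p (lin_comb B q) + p (\<Sum>e\<in>B. (x e - q e) *\<^sub>R e)"
      using p lin_comb_in_span[of B q] lin_comb_in_span[of B "\<lambda>e. x e - q e"]
      unfolding seminorm_on_def lin_comb_def by blast
    with 1 eq show ?thesis by simp
  qed
  have "{x \<in> space V. p (lin_comb B x) < 1} =
      (\<Union>q\<in>Q. {x \<in> space V. p (lin_comb B q) + L q x < 1})" (is "?l = ?r")
  proof
    show "?r \<subseteq> ?l" using lip by (fastforce intro: le_less_trans)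
    show "?l \<subseteq> ?r"
    proof
      fix x assume x: "x \<in> ?l"
      define P where "P = (\<Sum>e\<in>B. p e)"
      \<comment> \<open>Passing from \<open>x\<close> to \<open>q\<close> and back costs at most \<open>2 * \<epsilon> * P\<close>, which stays below \<open>1 - p (lin_comb B x)\<close>.\<close>
      define \<epsilon> where "\<epsilon> = (1 - p (lin_comb B x)) / (2 * (P + 1))"
      have P: "P \<ge> 0" unfolding P_def using pe by (simp add: sum_nonneg)
      have \<epsilon>: "\<epsilon> > 0" using x P by (auto simp: \<epsilon>_def)
      have "\<exists>q\<in>\<rat>. \<bar>x e - q\<bar> < \<epsilon>" for e
        using Rats_dense_in_real[of "x e - \<epsilon>" "x e"] \<epsilon> by force
      then obtain q0 where q0: "\<And>e. q0 e \<in> \<rat>" "\<And>e. \<bar>x e - q0 e\<bar> < \<epsilon>" by metis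
      define q where "q = restrict q0 B"
      have L1: "L q x \<le> \<epsilon> * P"
        unfolding L_def P_def sum_distrib_left using q0 pe
        by (intro sum_mono mult_right_mono) (auto simp: q_def less_imp_le)
      have "L x q = L q x" by (simp add: L_def abs_minus_commute)
      then have "p (lin_comb B q) + L q x \<le> p (lin_comb B x) + 2 * (\<epsilon> * P)"
        using lip[of q x] L1 by linarith
      also have "2 * (\<epsilon> * P) = (1 - p (lin_comb B x)) * (P / (P + 1))"
        using P by (simp add: \<epsilon>_def field_simps)
      also have "p (lin_comb B x) + \<dots> < 1"
      proof -
        have "(1 - p (lin_comb B x)) * (P / (P + 1)) < (1 - p (lin_comb B x)) * 1"
          using x P by (intro mult_strict_left_mono) auto
        then show ?thesis by simp
      qed
      finally have less: "p (lin_comb B q) + L q x < 1" .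
      moreover have "L q x \<ge> 0" unfolding L_def using pe by (simp add: sum_nonneg)
      moreover have "q \<in> Pi\<^sub>E B (\<lambda>_. \<rat>)" using q0 by (auto simp: q_def)
      ultimately have "q \<in> Q" by (auto simp: Q_def)
      then show "x \<in> ?r" using x less by auto
    qed
  qed
  moreover have "countable Q"
    unfolding Q_def by (rule countable_subset[OF _ countable_PiE[OF B, of "\<lambda>_. \<rat>"]])
      (auto simp: countable_rat)
  moreover have "{x \<in> space V. p (lin_comb B q) + L q x < 1} \<in> sets V" for q
    unfolding V_def L_def by measurable
  ultimately show ?thesis unfolding V_def by auto
qed

text \<open>
  Volume comparison: open balls of radius \<open>d / 2\<close> around the points of \<open>P\<close> are disjoint and lie in the
  ball of radius \<open>r + d / 2\<close> around \<open>t0\<close>, so their number is at most \<open>((r + d / 2) / (d / 2)) ^ card B\<close>.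
  The coordinate ball of a seminorm may be unbounded and of infinite volume.  The balls are therefore cut
  with coordinate boxes of proportional size: the sets used are balls of the larger seminorm \<open>max (p x) (max\<^sub>e \<bar>x e\<bar> / R)\<close>, which separates the points at least as well, and since \<open>P\<close> is
  finite a large \<open>R\<close> keeps all of \<open>P\<close> within distance \<open>r\<close> of \<open>t0\<close>.
\<close>

lemma seminorm_packing:
  fixes B P :: "'a::real_vector set"
  assumes B: "finite B" and p: "seminorm_on (span B) p"
    and P: "finite P" "P \<subseteq> span B" "t0 \<in> span B"
    and r: "r > 0" "\<And>s. s \<in> P \<Longrightarrow> p (s - t0) \<le> r"
    and d: "d > 0" "\<And>s t. s \<in> P \<Longrightarrow> t \<in> P \<Longrightarrow> s \<noteq> t \<Longrightarrow> d \<le> p (s - t)"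
  shows "real (card P) \<le> (1 + 2 * r / d) ^ card B"
proof -
  define V where "V = PiM B (\<lambda>_. lborel :: real measure)"
  interpret product_sigma_finite "\<lambda>_ :: 'a. lborel :: real measure" ..
  have "\<forall>s\<in>span B. \<exists>z. lin_comb B z = s"
    using span_lin_comb[OF B] by blast
  then obtain z where z: "\<And>s. s \<in> span B \<Longrightarrow> lin_comb B (z s) = s"
    by (auto simp: bchoice_iff)
  have pe: "0 \<le> p e" if "e \<in> B" for e
    using p that unfolding seminorm_on_def by (auto intro: span_base)
  define R where "R = 1 + (\<Sum>s\<in>P. \<Sum>e\<in>B. \<bar>z s e - z t0 e\<bar> / r)"
  have "(\<Sum>s\<in>P. \<Sum>e\<in>B. \<bar>z s e - z t0 e\<bar> / r) \<ge> 0"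
    using r by (intro sum_nonneg) auto
  then have R: "R > 0" unfolding R_def by linarith
  have zR: "\<bar>z s e - z t0 e\<bar> \<le> r * R" if "s \<in> P" "e \<in> B" for s e
  proof -
    have "\<bar>z s e - z t0 e\<bar> / r \<le> (\<Sum>e\<in>B. \<bar>z s e - z t0 e\<bar> / r)"
      using r that B by (intro member_le_sum) auto
    also have "\<dots> \<le> (\<Sum>s\<in>P. \<Sum>e\<in>B. \<bar>z s e - z t0 e\<bar> / r)"
      using r that P by (intro member_le_sum[of s P "\<lambda>s. \<Sum>e\<in>B. \<bar>z s e - z t0 e\<bar> / r"] sum_nonneg) auto
    finally have "\<bar>z s e - z t0 e\<bar> / r \<le> R" unfolding R_def by linarith
    then show ?thesis using r by (simp add: field_simps)
  qed
  define U where "U = {x \<in> space V. p (lin_comb B x) < 1 \<and> (\<forall>e\<in>B. \<bar>x e\<bar> < R)}"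
  \<comment> \<open>\<open>W y \<rho>\<close> is the truncated ball of radius \<open>\<rho>\<close> about \<open>y\<close>, written as a homothetic copy of \<open>U\<close>.\<close>
  define W where "W = (\<lambda>y \<rho>. {x \<in> space V. (\<lambda>e\<in>B. (x e - y e) / \<rho>) \<in> U})"
  have U: "U \<in> sets V"
  proof -
    have "U = {x \<in> space V. p (lin_comb B x) < 1} \<inter> {x \<in> space V. \<forall>e\<in>B. \<bar>x e\<bar> < R}"
      by (auto simp: U_def)
    moreover have "{x \<in> space V. \<forall>e\<in>B. \<bar>x e\<bar> < R} \<in> sets V"
      unfolding V_def using B by measurable
    ultimately show ?thesis
      using measurable_seminorm_ball[OF B p] unfolding V_def by auto
  qed
  have W: "W y \<rho> \<in> sets V" for y \<rho>
  proof -
    have "(\<lambda>x. \<lambda>e\<in>B. (x e - y e) / \<rho>) \<in> measurable V V"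
      unfolding V_def by (intro measurable_restrict) auto
    from measurable_sets[OF this U] show ?thesis
      by (simp add: W_def vimage_def Int_def conj_commute)
  qed
  have W_iff: "x \<in> W y \<rho> \<longleftrightarrow> x \<in> space V \<and> p (lin_comb B x - lin_comb B y) < \<rho> \<and>
      (\<forall>e\<in>B. \<bar>x e - y e\<bar> < \<rho> * R)" if "\<rho> > 0" for x y \<rho>
  proof -
    have "lin_comb B x - lin_comb B y \<in> span B"
      by (intro span_diff lin_comb_in_span)
    then have "p ((1 / \<rho>) *\<^sub>R (lin_comb B x - lin_comb B y)) = p (lin_comb B x - lin_comb B y) / \<rho>"
      using p that unfolding seminorm_on_def by auto
    then have "p ((1 / \<rho>) *\<^sub>R (lin_comb B x - lin_comb B y)) < 1 \<longleftrightarrow>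
        p (lin_comb B x - lin_comb B y) < \<rho>"
      using that by simp
    moreover have "\<bar>(x e - y e) / \<rho>\<bar> < R \<longleftrightarrow> \<bar>x e - y e\<bar> < \<rho> * R" for e
      using that by (simp add: pos_divide_less_eq mult.commute)
    ultimately show ?thesis
      by (simp add: W_def U_def V_def space_PiM lin_comb_homothety)
  qed
  have emW: "emeasure V (W y \<rho>) = ennreal (\<rho> ^ card B) * emeasure V U" if "\<rho> > 0" for y \<rho>
    using emeasure_PiM_lborel_homothety[OF B that, of U y] U unfolding W_def V_def by simp
  have Ufin: "emeasure V U < \<infinity>"
  proof -
    have "U \<subseteq> Pi\<^sub>E B (\<lambda>_. {-R..R})"
    proof
      fix x assume "x \<in> U"
      then have "x \<in> extensional B" "\<And>e. e \<in> B \<Longrightarrow> \<bar>x e\<bar> < R"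
        by (auto simp: U_def V_def space_PiM PiE_iff)
      then show "x \<in> Pi\<^sub>E B (\<lambda>_. {-R..R})"
        by (force simp: PiE_iff)
    qed
    moreover have "Pi\<^sub>E B (\<lambda>_. {-R..R}) \<in> sets V"
      unfolding V_def using B by (intro sets_PiM_I_finite) auto
    ultimately have "emeasure V U \<le> emeasure V (Pi\<^sub>E B (\<lambda>_. {-R..R}))"
      by (rule emeasure_mono)
    also have "\<dots> = (\<Prod>i\<in>B. emeasure lborel {-R..R})"
      unfolding V_def using B by (intro emeasure_PiM) auto
    also have "\<dots> < \<infinity>" using R by (simp add: ennreal_power)
    finally show ?thesis .
  qed
  have Upos: "emeasure V U > 0"
  proof -
    define Q where "Q = (\<Sum>e\<in>B. p e)"
    \<comment> \<open>A box of half-width \<open>\<epsilon>\<close> fits into \<open>U\<close>, because \<open>p\<close> is at most \<open>\<epsilon> * Q < 1\<close> on it.\<close>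
    define \<epsilon> where "\<epsilon> = min (R / 2) (1 / (Q + 1))"
    have Q: "Q \<ge> 0" unfolding Q_def using pe by (simp add: sum_nonneg)
    have \<epsilon>: "\<epsilon> > 0" using R Q by (auto simp: \<epsilon>_def)
    have "0 < (\<Prod>i\<in>B. emeasure lborel {-\<epsilon><..<\<epsilon>})"
      using \<epsilon> by (simp add: ennreal_power)
    also have "\<dots> = emeasure V (Pi\<^sub>E B (\<lambda>_. {-\<epsilon><..<\<epsilon>}))"
      unfolding V_def using B by (intro emeasure_PiM[symmetric]) auto
    also have "\<dots> \<le> emeasure V U"
    proof (rule emeasure_mono[OF _ U], rule)
      fix x assume x: "x \<in> Pi\<^sub>E B (\<lambda>_. {-\<epsilon><..<\<epsilon>})"
      then have xe: "\<bar>x e\<bar> < \<epsilon>" if "e \<in> B" for e using that by (force simp: PiE_iff abs_less_iff)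
      have "p (lin_comb B x) \<le> (\<Sum>e\<in>B. p (x e *\<^sub>R e))"
        unfolding lin_comb_def
        by (rule seminorm_on_sum[OF p subspace_span B]) (auto intro: span_base span_scale)
      also have "\<dots> = (\<Sum>e\<in>B. \<bar>x e\<bar> * p e)"
        using p by (intro sum.cong) (auto simp: seminorm_on_def intro: span_base)
      also have "\<dots> \<le> (\<Sum>e\<in>B. \<epsilon> * p e)"
        using pe xe by (intro sum_mono mult_right_mono) (auto simp: less_imp_le)
      also have "\<dots> = \<epsilon> * Q" by (simp add: Q_def sum_distrib_left)
      also have "\<dots> \<le> 1 / (Q + 1) * Q" using Q by (intro mult_right_mono) (auto simp: \<epsilon>_def)
      also have "\<dots> < 1" using Q by simp
      finally have "p (lin_comb B x) < 1" .
      moreover have "\<epsilon> < R" using R by (auto simp: \<epsilon>_def min_def)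
      moreover have "x \<in> space V"
        using x by (auto simp: V_def space_PiM PiE_iff)
      ultimately show "x \<in> U"
        using xe by (auto simp: U_def dest: less_trans)
    qed
    finally show ?thesis .
  qed
  define m where "m = measure V U"
  have m: "emeasure V U = ennreal m"
    using Ufin unfolding m_def by (intro emeasure_eq_ennreal_measure) auto
  then have m: "emeasure V U = ennreal m" "m > 0"
    using Upos by auto
  have disj: "disjoint_family_on (\<lambda>s. W (z s) (d / 2)) P"
    unfolding disjoint_family_on_def
  proof (intro ballI impI)
    fix s t assume st: "s \<in> P" "t \<in> P" "s \<noteq> t"
    show "W (z s) (d / 2) \<inter> W (z t) (d / 2) = {}"
    proof (rule ccontr)
      assume "\<not> ?thesis"
      then obtain x where x: "x \<in> W (z s) (d / 2)" "x \<in> W (z t) (d / 2)" by auto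
      let ?x = "lin_comb B x"
      have S: "s \<in> span B" "t \<in> span B" "?x \<in> span B" using st P lin_comb_in_span by auto
      have 1: "p (?x - s) < d / 2" "p (?x - t) < d / 2"
        using x W_iff[of "d / 2"] d z S by auto
      have "p (s - ?x) = p (?x - s)"
        using seminorm_on_minus[OF p, of "?x - s"] S by (simp add: span_diff)
      moreover have "p ((s - ?x) + (?x - t)) \<le> p (s - ?x) + p (?x - t)"
        using p S unfolding seminorm_on_def by (meson span_diff)
      ultimately have "p (s - t) < d" using 1 by simp
      then show False using d st by force
    qed
  qed
  have sub: "(\<Union>s\<in>P. W (z s) (d / 2)) \<subseteq> W (z t0) (r + d / 2)"
  proof
    fix x assume "x \<in> (\<Union>s\<in>P. W (z s) (d / 2))"
    then obtain s where s: "s \<in> P" and x: "x \<in> W (z s) (d / 2)" by auto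
    let ?x = "lin_comb B x"
    have S: "s \<in> span B" "t0 \<in> span B" "?x \<in> span B" using s P lin_comb_in_span by auto
    have x': "x \<in> space V" "p (?x - s) < d / 2" "\<And>e. e \<in> B \<Longrightarrow> \<bar>x e - z s e\<bar> < d / 2 * R"
      using x W_iff[of "d / 2"] d z S by auto
    have "p ((?x - s) + (s - t0)) \<le> p (?x - s) + p (s - t0)"
      using p S unfolding seminorm_on_def by (meson span_diff)
    then have "p (?x - t0) < r + d / 2" using x'(2) r(2)[OF s] by simp
    moreover have "\<bar>x e - z t0 e\<bar> < (r + d / 2) * R" if "e \<in> B" for e
      using x'(3)[OF that] zR[OF s that] unfolding distrib_right by linarith
    ultimately show "x \<in> W (z t0) (r + d / 2)"
      using W_iff[of "r + d / 2"] x'(1) r d z S by auto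
  qed
  have "ennreal (card P * ((d / 2) ^ card B * m)) = (\<Sum>s\<in>P. emeasure V (W (z s) (d / 2)))"
    using emW[of "d / 2"] d m by (simp add: ennreal_mult[symmetric] ennreal_of_nat_eq_real_of_nat)
  also have "\<dots> = emeasure V (\<Union>s\<in>P. W (z s) (d / 2))"
    using W disj P by (intro sum_emeasure) auto
  also have "\<dots> \<le> emeasure V (W (z t0) (r + d / 2))"
    by (rule emeasure_mono[OF sub W])
  also have "\<dots> = ennreal ((r + d / 2) ^ card B * m)"
    using emW[of "r + d / 2"] r d m by (simp add: ennreal_mult[symmetric])
  finally have "real (card P) * (d / 2) ^ card B \<le> (r + d / 2) ^ card B"
    using m r d by (simp add: ennreal_le_iff mult.assoc[symmetric])
  then have "real (card P) \<le> (r + d / 2) ^ card B / (d / 2) ^ card B"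
    using d(1) by (subst pos_le_divide_eq) auto
  then have "real (card P) \<le> ((r + d / 2) / (d / 2)) ^ card B"
    by (simp only: power_divide)
  also have "(r + d / 2) / (d / 2) = 1 + 2 * r / d"
    using d by (simp add: field_simps)
  finally show ?thesis .
qed

section \<open>Bernstein's tail bound\<close>

text \<open>
  Chernoff's method with the exact minimiser: for \<open>s = sqrt (2 * y / V)\<close> and \<open>l = s / (1 + B * s)\<close> the
  exponent \<open>l\<^sup>2 * V / (2 * (1 - l * B)) - l * (sqrt (2 * V * y) + B * y)\<close> equals \<open>- y\<close>.
\<close>

lemma (in prob_space) bernstein_tail:
  fixes Y :: "'a \<Rightarrow> real"
  assumes V: "V > 0" and B: "B \<ge> 0" and y: "y \<ge> 0"
    and mgf: "\<And>l. 0 \<le> l \<Longrightarrow> l * B < 1 \<Longrightarrow>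
        integrable M (\<lambda>w. exp (l * Y w)) \<and>
        expectation (\<lambda>w. exp (l * Y w)) \<le> exp (l\<^sup>2 * V / (2 * (1 - l * B)))"
  shows "prob {w \<in> space M. Y w \<ge> sqrt (2 * V * y) + B * y} \<le> exp (- y)"
proof (cases "y = 0")
  case True
  then show ?thesis by simp
next
  case False
  then have y: "y > 0" using y by simp
  define s where "s = sqrt (2 * y / V)"
  define l where "l = s / (1 + B * s)"
  have s: "s > 0" and s2: "s\<^sup>2 * V = 2 * y" using y V by (auto simp: s_def)
  have pos: "1 + B * s > 0" using B s by (simp add: add_pos_nonneg)
  have l: "l > 0" using s pos by (simp add: l_def)
  have l1: "1 - l * B = 1 / (1 + B * s)" using pos by (simp add: l_def field_simps)
  then have l2: "l * B < 1" using pos by (smt (verit) divide_pos_pos)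
  have sq: "sqrt (2 * V * y) = s * V"
  proof -
    have "2 * V * y = (s * V)\<^sup>2" using s2 by (simp add: power_mult_distrib power2_eq_square mult_ac)
    then show ?thesis using s V by (simp add: real_sqrt_abs)
  qed
  have e1: "l\<^sup>2 * V / (2 * (1 - l * B)) = y / (1 + B * s)"
  proof -
    have "l\<^sup>2 * V / (2 * (1 - l * B)) = (s\<^sup>2 * V) / (2 * (1 + B * s))"
      unfolding l1 using pos by (simp add: l_def power_divide power2_eq_square)
    then show ?thesis unfolding s2 by (simp only: mult_divide_mult_cancel_left[of 2] zero_neq_numeral[symmetric] not_False_eq_True)
  qed
  have e2: "l * (sqrt (2 * V * y) + B * y) = (2 * y + B * s * y) / (1 + B * s)"
  proof -
    have "l * (sqrt (2 * V * y) + B * y) = (s\<^sup>2 * V + B * s * y) / (1 + B * s)"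
      unfolding sq l_def by (simp add: power2_eq_square algebra_simps add_divide_distrib)
    then show ?thesis unfolding s2 .
  qed
  have e3: "y / (1 + B * s) - (2 * y + B * s * y) / (1 + B * s) = - y"
  proof -
    have "y - (2 * y + B * s * y) = - y * (1 + B * s)" by (simp add: algebra_simps)
    then show ?thesis using pos by (simp add: diff_divide_distrib[symmetric])
  qed
  have int: "integrable M (\<lambda>w. exp (l * Y w))"
    and le: "expectation (\<lambda>w. exp (l * Y w)) \<le> exp (l\<^sup>2 * V / (2 * (1 - l * B)))"
    using mgf[of l] l l2 by auto
  have set_int: "set_integrable M (space M) (\<lambda>w. exp (l * Y w))"
    unfolding set_integrable_def by (rule integrable_mult_indicator[OF sets.top int])
  have "prob {w \<in> space M. Y w \<ge> sqrt (2 * V * y) + B * y}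
      \<le> exp (- l * (sqrt (2 * V * y) + B * y)) * (\<integral>w\<in>space M. exp (l * Y w) \<partial>M)"
    by (rule Chernoff_ineq_ge[OF l]) (simp_all add: set_int)
  also have "(\<integral>w\<in>space M. exp (l * Y w) \<partial>M) = expectation (\<lambda>w. exp (l * Y w))"
    using int by (rule set_integral_space)
  also have "exp (- l * (sqrt (2 * V * y) + B * y)) * \<dots>
      \<le> exp (- l * (sqrt (2 * V * y) + B * y)) * exp (l\<^sup>2 * V / (2 * (1 - l * B)))"
    using le by (intro mult_left_mono) auto
  also have "\<dots> = exp (y / (1 + B * s) - (2 * y + B * s * y) / (1 + B * s))"
    unfolding exp_add[symmetric] e1 e2[symmetric] by simp
  also have "\<dots> = exp (- y)" unfolding e3 ..
  finally show ?thesis .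
qed

section \<open>Chaining over dyadic nets\<close>

text \<open>
  A separated set to which no point can be added is a net at the same scale.
\<close>

lemma exists_maximal_separated_subset:
  fixes \<rho> :: "'a \<Rightarrow> 'a \<Rightarrow> real"
  assumes F: "finite F" and refl: "\<And>s. s \<in> F \<Longrightarrow> \<rho> s s \<le> r" and sym: "\<And>s t. s \<in> F \<Longrightarrow> t \<in> F \<Longrightarrow> \<rho> s t = \<rho> t s"
  shows "\<exists>A\<subseteq>F. (\<forall>s\<in>A. \<forall>t\<in>A. s \<noteq> t \<longrightarrow> r < \<rho> s t) \<and> (\<forall>t\<in>F. \<exists>s\<in>A. \<rho> t s \<le> r)"
proof -
  let ?P = "\<lambda>A. A \<subseteq> F \<and> (\<forall>s\<in>A. \<forall>t\<in>A. s \<noteq> t \<longrightarrow> r < \<rho> s t)"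
  have "finite {A. ?P A}" "{A. ?P A} \<noteq> {}"
    using F by (auto intro: finite_subset[of _ "Pow F"])
  from finite_has_maximal[OF this] obtain A where A: "?P A"
    and max: "\<And>A'. ?P A' \<Longrightarrow> A \<subseteq> A' \<Longrightarrow> A = A'" by auto
  have "\<exists>s\<in>A. \<rho> t s \<le> r" if t: "t \<in> F" for t
  proof (rule ccontr)
    assume neg: "\<not> (\<exists>s\<in>A. \<rho> t s \<le> r)"
    then have far: "r < \<rho> t s" if "s \<in> A" for s using that by force
    have far': "r < \<rho> s t" if "s \<in> A" for s
      using far[OF that] sym[OF t, of s] that A by auto
    have "?P (insert t A)" using A t far far' by auto
    from max[OF this] have "t \<in> A" by auto
    then show False using neg refl[OF t] by auto
  qed
  then have "\<forall>t\<in>F. \<exists>s\<in>A. \<rho> t s \<le> r" by (rule ballI)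
  with conjunct1[OF A] conjunct2[OF A] show ?thesis
    by (intro exI[of _ A] conjI)
qed

text \<open>
  Every point is joined to \<open>t0\<close> by a chain whose \<open>k\<close>-th link leads from a point of the net of scale \<open>(1 / 2) ^ Suc k\<close>
  to a point of the net of scale \<open>(1 / 2) ^ k\<close> that is within this distance.  There are as many links at level \<open>k\<close> as points of the finer
  net.  Outside the event that some link at level \<open>k\<close> exceeds \<open>(1 / 2) ^ k * h (y k)\<close>, summation along the chain gives
  the bound \<open>u\<close>; by the hypothesis \<open>packing\<close>, the levels \<open>y k\<close> are so large that the union bound over all links of
  level \<open>k\<close> costs at most \<open>(1 / 2) ^ Suc k * \<epsilon>\<close>, and these costs add up to at most \<open>\<epsilon>\<close>.
\<close>

lemma (in prob_space) chaining_tail: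
  fixes X :: "'t \<Rightarrow> 'a \<Rightarrow> real" and \<rho> :: "'t \<Rightarrow> 't \<Rightarrow> real" and h :: "real \<Rightarrow> real"
  assumes F: "finite F" "t0 \<in> F"
    and X: "\<And>t. t \<in> F \<Longrightarrow> random_variable borel (X t)"
    and \<rho>_pos: "\<And>s t. s \<in> F \<Longrightarrow> t \<in> F \<Longrightarrow> s \<noteq> t \<Longrightarrow> 0 < \<rho> s t"
    and \<rho>_refl: "\<And>s. s \<in> F \<Longrightarrow> \<rho> s s = 0"
    and \<rho>_sym: "\<And>s t. s \<in> F \<Longrightarrow> t \<in> F \<Longrightarrow> \<rho> s t = \<rho> t s"
    and radius: "\<And>t. t \<in> F \<Longrightarrow> \<rho> t t0 \<le> 1"
    and h: "\<And>y. y \<ge> 0 \<Longrightarrow> 0 \<le> h y"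
    and tail: "\<And>s t y. s \<in> F \<Longrightarrow> t \<in> F \<Longrightarrow> s \<noteq> t \<Longrightarrow> 0 \<le> y \<Longrightarrow>
        prob {w \<in> space M. X t w - X s w \<ge> \<rho> t s * h y} \<le> exp (- y)"
    and y: "\<And>k. 0 \<le> y k"
    and packing: "\<And>k A. A \<subseteq> F \<Longrightarrow> (\<And>s t. s \<in> A \<Longrightarrow> t \<in> A \<Longrightarrow> s \<noteq> t \<Longrightarrow> (1 / 2) ^ Suc k < \<rho> s t) \<Longrightarrow>
        real (card A) * exp (- y k) \<le> (1 / 2) ^ Suc k * \<epsilon>"
    and bound: "\<And>n. (\<Sum>k<n. (1 / 2) ^ k * h (y k)) \<le> u"
  shows "prob {w \<in> space M. \<exists>t\<in>F. X t w - X t0 w > u} \<le> \<epsilon>"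
proof -
  define net where "net k A \<longleftrightarrow> A \<subseteq> F \<and> (\<forall>s\<in>A. \<forall>t\<in>A. s \<noteq> t \<longrightarrow> (1 / 2) ^ k < \<rho> s t) \<and>
      (\<forall>t\<in>F. \<exists>s\<in>A. \<rho> t s \<le> (1 / 2) ^ k)" for k :: nat and A
  have "\<exists>A. net k A" for k
  proof -
    have "\<rho> s s \<le> (1 / 2) ^ k" if "s \<in> F" for s using \<rho>_refl[OF that] by simp
    then show ?thesis
      unfolding net_def by (rule exists_maximal_separated_subset[OF F(1) _ \<rho>_sym])
  qed
  then obtain A where net: "\<And>k. net k (A k)" by metis
  note netD = net[unfolded net_def]
  have A_sub: "A k \<subseteq> F" for k
    by (rule conjunct1[OF netD])
  have A_sep: "(1 / 2) ^ k < \<rho> s t" if "s \<in> A k" "t \<in> A k" "s \<noteq> t" for k s t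
    by (rule conjunct1[OF conjunct2[OF netD], rule_format, OF that])
  have A_net: "\<exists>s\<in>A k. \<rho> t s \<le> (1 / 2) ^ k" if "t \<in> F" for k t
    by (rule conjunct2[OF conjunct2[OF netD], rule_format, OF that])
  \<comment> \<open>The coarsest net is the single point \<open>t0\<close>, where all chains end; it covers at scale \<open>1\<close>.\<close>
  define C where "C k = (if k = 0 then {t0} else A k)" for k
  have C: "C k \<subseteq> F" "finite (C k)" for k
    using A_sub[of k] finite_subset[OF A_sub F(1)] F by (auto simp: C_def)
  have "\<exists>s\<in>C k. \<rho> t s \<le> (1 / 2) ^ k" if "t \<in> F" for k t
    using A_net[OF that, of k] radius[OF that] by (auto simp: C_def)
  then have "\<exists>s. s \<in> C k \<and> \<rho> t s \<le> (1 / 2) ^ k" if "t \<in> F" for k t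
    using that by blast
  note some = someI_ex[OF this]
  define \<pi> where "\<pi> k t = (SOME s. s \<in> C k \<and> \<rho> t s \<le> (1 / 2) ^ k)" for k t
  have \<pi>: "\<pi> k t \<in> C k" "\<rho> t (\<pi> k t) \<le> (1 / 2) ^ k" if "t \<in> F" for k t
    using some[OF that] unfolding \<pi>_def by blast+
  \<comment> \<open>At a scale below the least distance between distinct points a net is all of \<open>F\<close>, so chains are
      finite.  The value \<open>1\<close> serves a one-point \<open>F\<close>.\<close>
  define m where "m = Min (insert 1 ((\<lambda>(s, t). \<rho> s t) ` {(s, t) \<in> F \<times> F. s \<noteq> t}))"
  have "finite {(s, t) \<in> F \<times> F. s \<noteq> t}"
    by (rule finite_subset[of _ "F \<times> F"]) (use F in auto)
  then have fin: "finite (insert 1 ((\<lambda>(s, t). \<rho> s t) ` {(s, t) \<in> F \<times> F. s \<noteq> t}))"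
    by blast
  then have "m > 0 \<longleftrightarrow> (\<forall>a\<in>insert 1 ((\<lambda>(s, t). \<rho> s t) ` {(s, t) \<in> F \<times> F. s \<noteq> t}). 0 < a)"
    unfolding m_def by (rule Min_gr_iff) simp
  then have m: "m > 0" using \<rho>_pos by auto
  have m_le: "m \<le> \<rho> s t" if "s \<in> F" "t \<in> F" "s \<noteq> t" for s t
  proof -
    have "(s, t) \<in> {(s, t) \<in> F \<times> F. s \<noteq> t}" using that by simp
    then have "(\<lambda>(s, t). \<rho> s t) (s, t) \<in> (\<lambda>(s, t). \<rho> s t) ` {(s, t) \<in> F \<times> F. s \<noteq> t}"
      by (rule imageI)
    then show ?thesis unfolding m_def using fin by (intro Min_le) auto
  qed
  obtain K where K: "(1 / 2) ^ K < m" using real_arch_pow_inv[OF m, of "1 / 2"] by auto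
  have FK: "F \<subseteq> C K"
  proof
    fix t assume t: "t \<in> F"
    have "\<pi> K t = t"
    proof (rule ccontr)
      assume "\<pi> K t \<noteq> t"
      moreover have "\<pi> K t \<in> F" using \<pi>(1)[OF t] C by auto
      ultimately have "m \<le> \<rho> t (\<pi> K t)" using m_le[OF t] by auto
      then show False using \<pi>(2)[OF t, of K] K by linarith
    qed
    then show "t \<in> C K" using \<pi>(1)[OF t, of K] by simp
  qed
  \<comment> \<open>A link from a point to itself has increment \<open>0\<close>; if \<open>h (y k) = 0\<close>, it would otherwise always count
      as a failure.\<close>
  define E where "E k t = {w \<in> space M. \<pi> k t \<noteq> t \<and> X t w - X (\<pi> k t) w \<ge> (1 / 2) ^ k * h (y k)}" for k t
  have \<pi>F: "\<pi> k t \<in> F" if "t \<in> F" for k t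
    using \<pi>(1)[OF that] C by auto
  have E: "E k t \<in> events" if "t \<in> F" for k t
  proof -
    have [measurable]: "random_variable borel (X t)" "random_variable borel (X (\<pi> k t))"
      using X that \<pi>F by auto
    show ?thesis unfolding E_def by measurable
  qed
  have CF: "t \<in> F" if "t \<in> C j" for j t
    by (rule subsetD[OF C(1) that])
  have UE: "(\<Union>t\<in>C (Suc j). E j t) \<in> events" for j
    by (intro sets.finite_UN C(2) E CF)
  have PE: "prob (E k t) \<le> exp (- y k)" if t: "t \<in> F" for k t
  proof (cases "\<pi> k t = t")
    case True
    then show ?thesis by (simp add: E_def)
  next
    case False
    have [measurable]: "random_variable borel (X t)" "random_variable borel (X (\<pi> k t))"
      using X t \<pi>F by auto
    have "E k t \<subseteq> {w \<in> space M. X t w - X (\<pi> k t) w \<ge> \<rho> t (\<pi> k t) * h (y k)}"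
      using mult_right_mono[OF \<pi>(2)[OF t, of k] h[OF y[of k]]] by (auto simp: E_def)
    then have "prob (E k t) \<le> prob {w \<in> space M. X t w - X (\<pi> k t) w \<ge> \<rho> t (\<pi> k t) * h (y k)}"
      by (intro finite_measure_mono) measurable
    also have "\<dots> \<le> exp (- y k)"
      using False t \<pi>F y by (intro tail) auto
    finally show ?thesis .
  qed
  have step: "X t w - X t0 w \<le> (\<Sum>j<k. (1 / 2) ^ j * h (y j))"
    if w: "w \<in> space M" "\<And>j t. j < K \<Longrightarrow> t \<in> C (Suc j) \<Longrightarrow> w \<notin> E j t"
      and "k \<le> K" "t \<in> C k" for k t w
    using that(3,4)
  proof (induction k arbitrary: t)
    case 0
    then show ?case by (simp add: C_def)
  next
    case (Suc k)
    have t: "t \<in> F" using Suc.prems C by auto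
    have "X (\<pi> k t) w - X t0 w \<le> (\<Sum>j<k. (1 / 2) ^ j * h (y j))"
      using Suc.prems \<pi>(1)[OF t, of k] by (intro Suc.IH) auto
    moreover have "X t w - X (\<pi> k t) w \<le> (1 / 2) ^ k * h (y k)"
    proof (cases "\<pi> k t = t")
      case True
      then show ?thesis using h[OF y[of k]] by simp
    next
      case False
      then show ?thesis using w(2)[of k t] w(1) Suc.prems by (auto simp: E_def)
    qed
    ultimately show ?case by simp
  qed
  have "{w \<in> space M. \<exists>t\<in>F. X t w - X t0 w > u} \<subseteq> (\<Union>j<K. \<Union>t\<in>C (Suc j). E j t)"
  proof (rule, rule ccontr)
    fix w assume w: "w \<in> {w \<in> space M. \<exists>t\<in>F. X t w - X t0 w > u}"
      and "w \<notin> (\<Union>j<K. \<Union>t\<in>C (Suc j). E j t)"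
    then have nE: "w \<notin> E j t" if "j < K" "t \<in> C (Suc j)" for j t using that by auto
    from w obtain t where t: "t \<in> F" "X t w - X t0 w > u" by auto
    have "X t w - X t0 w \<le> (\<Sum>j<K. (1 / 2) ^ j * h (y j))"
      using w nE t FK by (intro step) auto
    then show False using bound[of K] t by linarith
  qed
  then have "prob {w \<in> space M. \<exists>t\<in>F. X t w - X t0 w > u} \<le> prob (\<Union>j<K. \<Union>t\<in>C (Suc j). E j t)"
    by (rule finite_measure_mono) (intro sets.finite_UN finite_lessThan UE)
  also have "\<dots> \<le> (\<Sum>j<K. prob (\<Union>t\<in>C (Suc j). E j t))"
    using UE by (intro finite_measure_subadditive_finite) auto
  also have "\<dots> \<le> (\<Sum>j<K. \<Sum>t\<in>C (Suc j). prob (E j t))"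
    using E CF by (intro sum_mono finite_measure_subadditive_finite C(2)) auto
  also have "\<dots> \<le> (\<Sum>j<K. \<Sum>t\<in>C (Suc j). exp (- y j))"
    by (intro sum_mono PE CF)
  also have "\<dots> \<le> (\<Sum>j<K. (1 / 2) ^ Suc j * \<epsilon>)"
  proof (intro sum_mono)
    fix j
    have "(\<Sum>t\<in>C (Suc j). exp (- y j)) = real (card (A (Suc j))) * exp (- y j)"
      by (simp add: C_def)
    also have "\<dots> \<le> (1 / 2) ^ Suc j * \<epsilon>" by (rule packing[OF A_sub A_sep])
    finally show "(\<Sum>t\<in>C (Suc j). exp (- y j)) \<le> (1 / 2) ^ Suc j * \<epsilon>" .
  qed
  also have "\<dots> = (1 - (1 / 2) ^ K) * \<epsilon>"
    unfolding sum_distrib_right[symmetric] by (induction K) (auto simp: algebra_simps)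
  also have "\<dots> \<le> 1 * \<epsilon>"
  proof -
    have "0 \<le> (1 / 2) ^ Suc 0 * \<epsilon>" using packing[of "{}" 0] by simp
    then show ?thesis by (intro mult_right_mono) auto
  qed
  finally show ?thesis by simp
qed

text \<open>
  Continuity from below along an exhaustion of \<open>T\<close> by finite sets.
\<close>

lemma (in prob_space) prob_UN_le_finite:
  assumes T: "countable T" and E: "\<And>t. t \<in> T \<Longrightarrow> E t \<in> events"
    and le: "\<And>F. finite F \<Longrightarrow> F \<subseteq> T \<Longrightarrow> prob (\<Union>t\<in>F. E t) \<le> \<epsilon>"
  shows "prob (\<Union>t\<in>T. E t) \<le> \<epsilon>"
proof (cases "T = {}")
  case True
  then show ?thesis using le[of "{}"] by simp
next
  case False
  define G where "G n = (\<Union>t\<in>from_nat_into T ` {..n}. E t)" for n :: nat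
  have sub: "from_nat_into T ` {..n} \<subseteq> T" for n :: nat
    using from_nat_into[OF False] by auto
  have "(\<lambda>n. prob (G n)) \<longlonglongrightarrow> prob (\<Union>n. G n)"
  proof (rule finite_Lim_measure_incseq)
    show "range G \<subseteq> events"
      using E sub unfolding G_def by (blast intro: sets.finite_UN)
    show "incseq G" unfolding G_def incseq_def by (intro allI impI UN_mono) auto
  qed
  moreover have "prob (G n) \<le> \<epsilon>" for n
    unfolding G_def using sub by (intro le) auto
  ultimately have "prob (\<Union>n. G n) \<le> \<epsilon>" by (intro LIMSEQ_le_const2) auto
  moreover have "(\<Union>t\<in>T. E t) = (\<Union>n. G n)"
  proof -
    have "T = (\<Union>n. from_nat_into T ` {..n})"
      using range_from_nat_into[OF False T] by blast
    then show ?thesis unfolding G_def by blast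
  qed
  ultimately show ?thesis by simp
qed

text \<open>
  This is the deviation accumulated along a chain at the levels \<open>y k = (2 * k + 4) * N\<close>.  Since \<open>sqrt (2 * a) \<le> a\<close> for
  \<open>a \<ge> 2\<close>, both contributions are dominated by the same series \<open>\<Sum>k. (2 * k + 4) / 2 ^ k = 12\<close>.
\<close>

lemma chaining_series:
  fixes v b N :: real
  assumes "v \<ge> 0" "b \<ge> 0" "N \<ge> 0"
  shows "(\<Sum>k<n. (1 / 2) ^ k * (v * sqrt (2 * ((2 * real k + 4) * N)) + b * ((2 * real k + 4) * N)))
           \<le> 12 * (v * sqrt N + b * N)" (is "(\<Sum>k<n. ?a k) \<le> _")
proof -
  define m where "m = v * sqrt N + b * N"
  have m: "m \<ge> 0" using assms by (simp add: m_def)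
  have "?a k \<le> (1 / 2) ^ k * (2 * real k + 4) * m" for k
  proof -
    define c where "c = 2 * real k + 4"
    have c: "c \<ge> 2" by (simp add: c_def)
    have "sqrt (2 * c) \<le> c"
      using c by (intro real_le_lsqrt) (auto simp: power2_eq_square)
    then have "sqrt (2 * (c * N)) \<le> c * sqrt N"
      using assms by (simp add: real_sqrt_mult mult.assoc[symmetric] mult_right_mono)
    then have "v * sqrt (2 * (c * N)) \<le> v * (c * sqrt N)"
      using assms by (intro mult_left_mono)
    then have "(1 / 2) ^ k * (v * sqrt (2 * (c * N)) + b * (c * N)) \<le> (1 / 2) ^ k * (c * m)"
      by (intro mult_left_mono) (auto simp: m_def algebra_simps)
    then show ?thesis by (simp add: c_def mult.assoc)
  qed
  then have "(\<Sum>k<n. ?a k) \<le> (\<Sum>k<n. (1 / 2) ^ k * (2 * real k + 4)) * m"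
    unfolding sum_distrib_right by (intro sum_mono)
  also have "(\<Sum>k<n. (1 / 2) ^ k * (2 * real k + 4)) = 12 - (1 / 2) ^ n * (4 * real n + 12)"
    by (induction n) (auto simp: algebra_simps)
  also have "\<dots> * m \<le> 12 * m" using m by (intro mult_right_mono) auto
  finally show ?thesis unfolding m_def .
qed

text \<open>
  The packing bound at scale \<open>(1 / 2) ^ Suc k\<close> is at most \<open>2 ^ ((k + 3) * D)\<close>.  As \<open>exp (- 1) \<le> 1 / 2\<close>, the factor
  \<open>exp (- (2 * k + 4) * D)\<close> absorbs it and leaves \<open>(1 / 2) ^ ((k + 1) * D)\<close>; this is where the levels
  \<open>(2 * k + 4) * (D + x)\<close> come from.
\<close>

lemma net_card_weight:
  fixes D :: nat and x :: real
  assumes D: "D \<ge> 1" and x: "x \<ge> 0"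
    and n: "n \<le> (1 + 2 * 1 / (1 / 2) ^ Suc k) ^ D"
  shows "n * exp (- ((2 * real k + 4) * (real D + x))) \<le> (1 / 2) ^ Suc k * exp (- x)"
proof -
  have "1 + 2 * 1 / (1 / 2) ^ Suc k \<le> (2::real) ^ (k + 3)"
  proof -
    have "(1::real) \<le> 2 ^ k" by simp
    then have "(1::real) \<le> 4 * 2 ^ k" by linarith
    then show ?thesis by (simp add: power_divide power_add)
  qed
  then have "(1 + 2 * 1 / (1 / 2) ^ Suc k) ^ D \<le> ((2::real) ^ (k + 3)) ^ D"
    by (intro power_mono) auto
  with n have n: "n \<le> 2 ^ ((k + 3) * D)" by (simp add: power_mult)
  have "exp (- ((2 * real k + 4) * real D)) = exp (- 1) ^ ((2 * k + 4) * D)"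
    by (simp add: exp_of_nat_mult[symmetric])
  also have "\<dots> \<le> (1 / 2) ^ ((2 * k + 4) * D)"
    using exp_ge_add_one_self[of "1::real"] by (intro power_mono) (auto simp: exp_minus divide_simps)
  finally have e: "exp (- ((2 * real k + 4) * real D)) \<le> (1 / 2) ^ ((2 * k + 4) * D)" .
  have "1 * x \<le> (2 * real k + 4) * x" using x by (intro mult_right_mono) auto
  then have ex: "exp (- ((2 * real k + 4) * x)) \<le> exp (- x)" by simp
  have "n * exp (- ((2 * real k + 4) * (real D + x)))
      = n * exp (- ((2 * real k + 4) * real D)) * exp (- ((2 * real k + 4) * x))"
    by (simp add: exp_add[symmetric] algebra_simps)
  also have "\<dots> \<le> 2 ^ ((k + 3) * D) * (1 / 2) ^ ((2 * k + 4) * D) * exp (- x)"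
    using n e ex by (intro mult_mono) auto
  also have "(2::real) ^ ((k + 3) * D) * (1 / 2) ^ ((2 * k + 4) * D) = (1 / 2) ^ (Suc k * D)"
  proof -
    have "(2 * k + 4) * D = (k + 3) * D + Suc k * D" by (simp add: algebra_simps)
    then show ?thesis by (simp add: power_add power_mult_distrib[symmetric] mult.assoc[symmetric])
  qed
  also have "(1 / 2) ^ (Suc k * D) * exp (- x) \<le> (1 / 2) ^ Suc k * exp (- x)"
  proof -
    have "Suc k * 1 \<le> Suc k * D" using D by (intro mult_le_mono2)
    then show ?thesis by (intro mult_right_mono power_decreasing) auto
  qed
  finally show ?thesis .
qed

section \<open>Suprema of Bernstein-type processes\<close>

lemma norm_on_imp_seminorm_on: "norm_on S N \<Longrightarrow> seminorm_on S N"
  by (auto simp: norm_on_def seminorm_on_def)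

lemma norm_on_zero: "norm_on S N \<Longrightarrow> 0 \<in> S \<Longrightarrow> N 0 = 0"
  by (simp add: norm_on_def)

lemma seminorm_on_scale:
  assumes "seminorm_on S p" "a \<ge> 0"
  shows "seminorm_on S (\<lambda>x. a * p x)"
  unfolding seminorm_on_def
proof (intro conjI ballI allI)
  fix x y assume xy: "x \<in> S" "y \<in> S"
  have "a * p (x + y) \<le> a * (p x + p y)"
    using assms xy by (intro mult_left_mono) (auto simp: seminorm_on_def)
  then show "a * p (x + y) \<le> a * p x + a * p y" by (simp add: distrib_left)
qed (use assms in \<open>auto simp: seminorm_on_def\<close>)

lemma seminorm_on_max:
  assumes "seminorm_on S p" "seminorm_on S q"
  shows "seminorm_on S (\<lambda>x. max (p x) (q x))"
  unfolding seminorm_on_def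
proof (intro conjI ballI allI)
  fix x y assume "x \<in> S" "y \<in> S"
  then have "p (x + y) \<le> p x + p y" "q (x + y) \<le> q x + q y"
    using assms by (auto simp: seminorm_on_def)
  then show "max (p (x + y)) (q (x + y)) \<le> max (p x) (q x) + max (p y) (q y)" by linarith
qed (use assms in \<open>auto simp: seminorm_on_def max_mult_distrib_left le_max_iff_disj\<close>)

lemma seminorm_on_diff_commute:
  assumes "seminorm_on S p" "subspace S" "x \<in> S" "y \<in> S"
  shows "p (x - y) = p (y - x)"
  using seminorm_on_minus[OF assms(1), of "x - y"] subspace_diff[OF assms(2-4)] by simp

text \<open>
  Distances are measured by the seminorm \<open>p x = max (N2 x / v) (c / b * Ninf x)\<close>.  In it \<open>F\<close> has radius \<open>1\<close> about \<open>t0\<close>,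
  and a bound on \<open>p (t - s)\<close> controls both parameters of the Bernstein tail of \<open>X t - X s\<close> at once, whatever
  the two norms are.
\<close>

lemma (in prob_space) finite_increment_tail:
  fixes S F :: "'t::real_vector set" and X :: "'t \<Rightarrow> 'a \<Rightarrow> real"
  assumes S: "finite_dim_space S D" and N2: "norm_on S N2" and Ninf: "norm_on S Ninf"
    and F: "finite F" "t0 \<in> F"
    and X: "\<And>t. t \<in> F \<Longrightarrow> random_variable borel (X t)"
    and v: "v > 0" and b: "b \<ge> 0" and c: "c \<ge> 0"
    and FS: "F \<subseteq> {t \<in> S. N2 (t - t0) \<le> v \<and> c * Ninf (t - t0) \<le> b}"
    and bern: "bernstein_increments M F X N2 Ninf c"
    and x: "x \<ge> 0"
  shows "prob {w \<in> space M. \<exists>t\<in>F. X t w - X t0 w > 12 * (v * sqrt (real D + x) + b * (real D + x))}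
           \<le> exp (- x)"
proof -
  have sS: "subspace S" and "\<exists>B. finite B \<and> span B = S" and dim: "dim S = D"
    using S by (auto simp: finite_dim_space_def)
  then obtain B0 where B0: "finite B0" "span B0 = S" by auto
  obtain B where B: "B \<subseteq> S" "independent B" "S \<subseteq> span B" "card B = D"
    using basis_exists[of S] dim by metis
  have finB: "finite B" using independent_span_bound[OF B0(1) B(2)] B B0 by auto
  have spanB: "span B = S" using B sS by (simp add: span_subspace)
  have FinS: "t \<in> S" if "t \<in> F" for t using FS that by auto
  have dS: "t - s \<in> S" if "s \<in> F" "t \<in> F" for s t using subspace_diff[OF sS] FinS that by auto
  have sn2: "seminorm_on S N2" and sni: "seminorm_on S Ninf"
    using N2 Ninf by (auto intro: norm_on_imp_seminorm_on)
  define p where "p x = max (1 / v * N2 x) (c / b * Ninf x)" for x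
  have p: "seminorm_on S p"
    unfolding p_def using sn2 sni v b c by (intro seminorm_on_max seminorm_on_scale) auto
  have radius: "p (t - t0) \<le> 1" if "t \<in> F" for t
  proof -
    have "N2 (t - t0) \<le> v" "c * Ninf (t - t0) \<le> b" using FS that by auto
    then show ?thesis using v b by (auto simp: p_def divide_simps)
  qed
  have le2: "N2 y \<le> v * p y" for y
  proof -
    have "1 / v * N2 y \<le> p y" by (simp add: p_def)
    then show ?thesis using v by (simp add: field_simps)
  qed
  \<comment> \<open>If \<open>b = 0\<close>, then \<open>c / b\<close> is \<open>0\<close> and \<open>p\<close> ignores \<open>Ninf\<close>; but then \<open>c * Ninf\<close> vanishes on all increments of \<open>F\<close>.\<close>
  have lei: "c * Ninf (t - s) \<le> b * p (t - s)" if st: "s \<in> F" "t \<in> F" for s t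
  proof (cases "b = 0")
    case True
    have "Ninf ((t - t0) + (t0 - s)) \<le> Ninf (t - t0) + Ninf (t0 - s)"
      using sni dS st F unfolding seminorm_on_def by blast
    also have "Ninf (t0 - s) = Ninf (s - t0)"
      using seminorm_on_diff_commute[OF sni sS] FinS st F by auto
    finally have "c * Ninf (t - s) \<le> c * (Ninf (t - t0) + Ninf (s - t0))"
      using c by (intro mult_left_mono) auto
    also have "\<dots> \<le> 0"
    proof -
      have "c * Ninf (t - t0) \<le> 0" "c * Ninf (s - t0) \<le> 0" using FS st True by auto
      then show ?thesis by (simp add: distrib_left)
    qed
    finally show ?thesis using True by simp
  next
    case False
    have "c / b * Ninf (t - s) \<le> p (t - s)" by (simp add: p_def)
    then show ?thesis using False b by (simp add: field_simps)
  qed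
  have N2pos: "N2 (t - s) > 0" if "s \<in> F" "t \<in> F" "s \<noteq> t" for s t
    using N2 dS[OF that(1,2)] that(3) unfolding norm_on_def by (metis eq_iff_diff_eq_0 order_less_le)
  define h where "h y = v * sqrt (2 * y) + b * y" for y
  define u where "u = 12 * (v * sqrt (real D + x) + b * (real D + x))"
  show ?thesis
  proof (cases "D = 0")
    case True
    \<comment> \<open>In dimension \<open>0\<close> the cardinality bound gains nothing from \<open>D\<close>, but \<open>F\<close> is a single point.\<close>
    then have "B = {}" using B finB by auto
    then have "S = {0}" using spanB by simp
    then have "F \<subseteq> {t0}" using FinS F by auto
    moreover have "u \<ge> 0" unfolding u_def using v b x by simp
    ultimately have "{w \<in> space M. \<exists>t\<in>F. X t w - X t0 w > u} = {}" by auto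
    then show ?thesis unfolding u_def[symmetric] by (simp only: measure_empty) simp
  next
    case False
    show ?thesis
    proof (rule chaining_tail[where \<rho> = "\<lambda>s t. p (s - t)" and h = h and
          y = "\<lambda>k. (2 * real k + 4) * (real D + x)"])
      show "0 < p (s - t)" if "s \<in> F" "t \<in> F" "s \<noteq> t" for s t
      proof -
        have "0 < v * p (s - t)" using N2pos[of t s] le2[of "s - t"] that by auto
        then show ?thesis using v by (simp add: zero_less_mult_iff)
      qed
      have "N2 0 = 0" "Ninf 0 = 0"
        using subspace_0[OF sS] N2 Ninf by (simp_all add: norm_on_zero)
      then show "p (s - s) = 0" for s by (simp add: p_def)
      show "p (s - t) = p (t - s)" if "s \<in> F" "t \<in> F" for s t
        using seminorm_on_diff_commute[OF p sS] FinS that by auto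
      show "0 \<le> h y" if "y \<ge> 0" for y using that v b by (simp add: h_def)
      show "prob {w \<in> space M. X t w - X s w \<ge> p (t - s) * h y} \<le> exp (- y)"
        if st: "s \<in> F" "t \<in> F" "s \<noteq> t" and y: "0 \<le> y" for s t y
      proof -
        define V where "V = (N2 (t - s))\<^sup>2"
        define C where "C = c * Ninf (t - s)"
        have [measurable]: "random_variable borel (X t)" "random_variable borel (X s)"
          using X st by auto
        have n2: "N2 (t - s) > 0" using N2pos st by auto
        have C0: "C \<ge> 0" unfolding C_def using c sni dS st by (simp add: seminorm_on_def)
        have "sqrt (2 * V * y) = N2 (t - s) * sqrt (2 * y)"
          using n2 by (simp add: V_def real_sqrt_mult)
        also have "\<dots> \<le> v * p (t - s) * sqrt (2 * y)"
          using le2 y by (intro mult_right_mono) auto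
        finally have "sqrt (2 * V * y) + C * y \<le> v * p (t - s) * sqrt (2 * y) + b * p (t - s) * y"
          using lei st y unfolding C_def by (intro add_mono mult_right_mono) auto
        also have "\<dots> = p (t - s) * h y" by (simp add: h_def algebra_simps)
        finally have "prob {w \<in> space M. X t w - X s w \<ge> p (t - s) * h y}
            \<le> prob {w \<in> space M. X t w - X s w \<ge> sqrt (2 * V * y) + C * y}"
          by (intro finite_measure_mono) auto
        also have "\<dots> \<le> exp (- y)"
        proof (rule bernstein_tail)
          fix l :: real assume l: "0 \<le> l" "l * C < 1"
          have "ereal l < 1 / ereal C"
          proof (cases "C = 0")
            case True
            then show ?thesis by (simp add: divide_ereal_def)
          next
            case False
            then show ?thesis using l C0 by (simp add: one_ereal_def field_simps)
          qed
          then show "integrable M (\<lambda>w. exp (l * (X t w - X s w))) \<and>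
              expectation (\<lambda>w. exp (l * (X t w - X s w))) \<le> exp (l\<^sup>2 * V / (2 * (1 - l * C)))"
            using bern st l unfolding bernstein_increments_def V_def C_def
            by (auto simp: mult.assoc)
        qed (use n2 C0 y in \<open>auto simp: V_def\<close>)
        finally show ?thesis .
      qed
      show "real (card A) * exp (- ((2 * real k + 4) * (real D + x))) \<le> (1 / 2) ^ Suc k * exp (- x)"
        if A: "A \<subseteq> F" "\<And>s t. s \<in> A \<Longrightarrow> t \<in> A \<Longrightarrow> s \<noteq> t \<Longrightarrow> (1 / 2) ^ Suc k < p (s - t)" for k A
      proof (rule net_card_weight)
        have "real (card A) \<le> (1 + 2 * 1 / (1 / 2) ^ Suc k) ^ card B"
        proof (rule seminorm_packing[where p = p and ?t0.0 = t0])
          show "finite A" using A F finite_subset by auto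
          show "(1 / 2) ^ Suc k \<le> p (s - t)" if "s \<in> A" "t \<in> A" "s \<noteq> t" for s t
            using A(2)[OF that] by simp
        qed (use finB spanB p A F FinS radius in auto)
        then show "real (card A) \<le> (1 + 2 * 1 / (1 / 2) ^ Suc k) ^ D" using B by simp
      qed (use False x in auto)
      show "(\<Sum>k<n. (1 / 2) ^ k * h ((2 * real k + 4) * (real D + x)))
          \<le> 12 * (v * sqrt (real D + x) + b * (real D + x))" for n
        unfolding h_def using v b x by (intro chaining_series) auto
    qed (use F X radius x in auto)
  qed
qed

lemma (in prob_space) countable_increment_tail:
  fixes S T :: "'t::real_vector set" and X :: "'t \<Rightarrow> 'a \<Rightarrow> real"
  assumes S: "finite_dim_space S D" and N2: "norm_on S N2" and Ninf: "norm_on S Ninf"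
    and T: "countable T" "t0 \<in> T"
    and X: "\<And>t. t \<in> T \<Longrightarrow> random_variable borel (X t)"
    and v: "v > 0" and b: "b \<ge> 0" and c: "c \<ge> 0"
    and TS: "T \<subseteq> {t \<in> S. N2 (t - t0) \<le> v \<and> c * Ninf (t - t0) \<le> b}"
    and bern: "bernstein_increments M T X N2 Ninf c"
    and x: "x \<ge> 0"
  defines "u \<equiv> 12 * (v * sqrt (real D + x) + b * (real D + x))"
  defines "E \<equiv> {w \<in> space M. \<exists>t\<in>T. X t w - X t0 w > u}"
  shows "E \<in> events" "prob E \<le> exp (- x)"
proof -
  define G where "G t = {w \<in> space M. X t w - X t0 w > u}" for t
  have G: "G t \<in> events" if "t \<in> T" for t
  proof -
    have [measurable]: "random_variable borel (X t)" "random_variable borel (X t0)"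
      using X T that by auto
    show ?thesis unfolding G_def by measurable
  qed
  have E: "E = (\<Union>t\<in>T. G t)" by (auto simp: E_def G_def)
  show "E \<in> events" unfolding E using T G by (intro sets.countable_UN') auto
  show "prob E \<le> exp (- x)"
    unfolding E
  proof (rule prob_UN_le_finite[OF T(1) G])
    fix F assume F: "finite F" "F \<subseteq> T"
    have sub: "insert t0 F \<subseteq> T" using F T by auto
    have "(\<Union>t\<in>F. G t) \<subseteq> (\<Union>t\<in>insert t0 F. G t)" by auto
    then have "prob (\<Union>t\<in>F. G t) \<le> prob (\<Union>t\<in>insert t0 F. G t)"
      using F sub G by (intro finite_measure_mono sets.finite_UN) auto
    also have "(\<Union>t\<in>insert t0 F. G t) = {w \<in> space M. \<exists>t\<in>insert t0 F. X t w - X t0 w > u}"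
      unfolding G_def by blast
    also have "prob \<dots> \<le> exp (- x)"
      unfolding u_def
    proof (rule finite_increment_tail[OF S N2 Ninf _ _ _ v b c _ _ x])
      show "bernstein_increments M (insert t0 F) X N2 Ninf c"
        using bern sub unfolding bernstein_increments_def by blast
    qed (use F sub X TS in auto)
    finally show "prob (\<Union>t\<in>F. G t) \<le> exp (- x)" .
  qed
qed

text \<open>
  Negating the process exchanges the roles of \<open>s\<close> and \<open>t\<close> in the hypothesis, which is symmetric in them.  Lower
  deviations of \<open>X\<close> are thereby upper deviations of \<open>- X\<close>.
\<close>

lemma bernstein_increments_uminus:
  assumes "bernstein_increments M T X N2 Ninf c"
    and "\<And>s t. s \<in> T \<Longrightarrow> t \<in> T \<Longrightarrow> N2 (t - s) = N2 (s - t)"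
    and "\<And>s t. s \<in> T \<Longrightarrow> t \<in> T \<Longrightarrow> Ninf (t - s) = Ninf (s - t)"
  shows "bernstein_increments M T (\<lambda>t w. - X t w) N2 Ninf c"
  unfolding bernstein_increments_def
proof (intro ballI impI allI)
  fix s t l assume st: "s \<in> T" "t \<in> T" "s \<noteq> t"
    and l: "0 \<le> l \<and> ereal l < 1 / ereal (c * Ninf (t - s))"
  have "- X t w - - X s w = X s w - X t w" for w by simp
  then show "integrable M (\<lambda>w. exp (l * (- X t w - - X s w))) \<and>
      (LINT w|M. exp (l * (- X t w - - X s w)))
        \<le> exp (l\<^sup>2 * (N2 (t - s))\<^sup>2 / (2 * (1 - l * c * Ninf (t - s))))"
    using assms(1) st l assms(2,3)[of s t] unfolding bernstein_increments_def by simp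
qed

theorem theorem2:
  fixes S T :: "'a::real_vector set" and D :: nat
    and N2 Ninf :: "'a \<Rightarrow> real" and t0 :: 'a
    and M :: "'w measure" and X :: "'a \<Rightarrow> 'w \<Rightarrow> real"
    and v b c :: real
  assumes "finite_dim_space S D"
    and "norm_on S N2" and "norm_on S Ninf"
    and "countable T" and "t0 \<in> T"
    and "prob_space M"
    and "\<And>t. t \<in> T \<Longrightarrow> centered_rv M (X t)"
    and "v > 0" and "b \<ge> 0" and "c \<ge> 0"
    and "T \<subseteq> {t \<in> S. N2 (t - t0) \<le> v \<and> c * Ninf (t - t0) \<le> b}"
    and "bernstein_increments M T X N2 Ninf c"
  shows "(\<forall>x::real. x \<ge> 0 \<longrightarrow>
            measure M {w \<in> space M. sup_increment X T t0 w
                \<ge> ereal (18 * (sqrt (v\<^sup>2 * (real D + x)) + b * (real D + x)))} \<le> exp (- x)) \<and>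
         (\<forall>x::real. x \<ge> 0 \<longrightarrow>
            measure M {w \<in> space M. sup_abs_increment X T t0 w
                \<ge> ereal (18 * (sqrt (v\<^sup>2 * (real D + x)) + b * (real D + x)))} \<le> 2 * exp (- x))"
proof -
  interpret prob_space M by fact
  define u where "u x = 12 * (v * sqrt (real D + x) + b * (real D + x))" for x
  define \<tau> where "\<tau> x = 18 * (sqrt (v\<^sup>2 * (real D + x)) + b * (real D + x))" for x
  define E where "E x = {w \<in> space M. \<exists>t\<in>T. X t w - X t0 w > u x}" for x
  define E' where "E' x = {w \<in> space M. \<exists>t\<in>T. - X t w - - X t0 w > u x}" for x
  have X: "random_variable borel (X t)" if "t \<in> T" for t
    using assms(7)[OF that] by (simp add: centered_rv_def)
  have S: "subspace S" "T \<subseteq> S" using assms(1,11) by (auto simp: finite_dim_space_def)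
  have E: "E x \<in> events" "prob (E x) \<le> exp (- x)" if "x \<ge> 0" for x
    unfolding E_def u_def
    using countable_increment_tail[OF assms(1-5) X assms(8-12) that] by auto
  have "bernstein_increments M T (\<lambda>t w. - X t w) N2 Ninf c"
    using assms(12)
  proof (rule bernstein_increments_uminus)
    fix s t assume "s \<in> T" "t \<in> T"
    then have "s \<in> S" "t \<in> S" using S by auto
    then show "N2 (t - s) = N2 (s - t)" "Ninf (t - s) = Ninf (s - t)"
      using assms(2,3) S by (auto intro: seminorm_on_diff_commute norm_on_imp_seminorm_on)
  qed
  then have E': "E' x \<in> events" "prob (E' x) \<le> exp (- x)" if "x \<ge> 0" for x
    unfolding E'_def u_def
    using countable_increment_tail[OF assms(1-5) _ assms(8-11) _ that, of "\<lambda>t w. - X t w"] X by auto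
  \<comment> \<open>A supremum that reaches \<open>\<tau>\<close> need not be attained; the gap below \<open>\<tau>\<close> provides an index beyond \<open>u\<close>.
      At \<open>x = 0\<close> the gap may close, but there the claims are trivial.\<close>
  have less: "u x < \<tau> x" if "x > 0" for x
  proof -
    have "0 < v * sqrt (real D + x)" using assms(8) that by simp
    moreover have "0 \<le> b * (real D + x)" using assms(9) that by simp
    moreover have "sqrt (v\<^sup>2 * (real D + x)) = v * sqrt (real D + x)"
      using assms(8) by (simp add: real_sqrt_mult)
    ultimately show ?thesis unfolding u_def \<tau>_def by simp
  qed
  have sup: "{w \<in> space M. sup_increment X T t0 w \<ge> ereal (\<tau> x)} \<subseteq> E x" if "x > 0" for x
  proof
    fix w assume w: "w \<in> {w \<in> space M. sup_increment X T t0 w \<ge> ereal (\<tau> x)}"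
    have "ereal (u x) < ereal (\<tau> x)" using less[OF that] by simp
    also have "\<dots> \<le> (SUP t\<in>T. ereal (X t w - X t0 w))" using w by (simp add: sup_increment_def)
    finally show "w \<in> E x" using w by (auto simp: E_def less_SUP_iff)
  qed
  have abs: "{w \<in> space M. sup_abs_increment X T t0 w \<ge> ereal (\<tau> x)} \<subseteq> E x \<union> E' x" if "x > 0" for x
  proof
    fix w assume w: "w \<in> {w \<in> space M. sup_abs_increment X T t0 w \<ge> ereal (\<tau> x)}"
    have "ereal (u x) < ereal (\<tau> x)" using less[OF that] by simp
    also have "\<dots> \<le> (SUP t\<in>T. ereal \<bar>X t w - X t0 w\<bar>)" using w by (simp add: sup_abs_increment_def)
    finally obtain t where "t \<in> T" "u x < \<bar>X t w - X t0 w\<bar>" by (auto simp: less_SUP_iff)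
    then show "w \<in> E x \<union> E' x" using w unfolding E_def E'_def abs_if by (auto split: if_splits)
  qed
  have "prob {w \<in> space M. sup_increment X T t0 w \<ge> ereal (\<tau> x)} \<le> exp (- x)" if "x \<ge> 0" for x
  proof (cases "x = 0")
    case False
    then show ?thesis
      using finite_measure_mono[OF sup E(1), of x] E(2)[of x] that by simp
  qed simp
  moreover have "prob {w \<in> space M. sup_abs_increment X T t0 w \<ge> ereal (\<tau> x)} \<le> 2 * exp (- x)"
    if "x \<ge> 0" for x
  proof (cases "x = 0")
    case True
    have "prob {w \<in> space M. sup_abs_increment X T t0 w \<ge> ereal (\<tau> x)} \<le> 1" by (rule prob_le_1)
    also have "1 \<le> 2 * exp (- x)" using True by simp
    finally show ?thesis .
  next
    case False
    have "prob {w \<in> space M. sup_abs_increment X T t0 w \<ge> ereal (\<tau> x)} \<le> prob (E x \<union> E' x)"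
      using False that E E' by (intro finite_measure_mono abs) auto
    also have "\<dots> \<le> prob (E x) + prob (E' x)"
      using E E' that by (intro measure_Un_le) auto
    finally show ?thesis using E(2) E'(2) that by (smt (verit))
  qed
  ultimately show ?thesis unfolding \<tau>_def by blast
qed

end
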